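(* (i) If $A,B$ are complex $2\times 2$ matrices such that $C=AB-BA$ satisfies $CA=AC$, then $A$ and $B$ are ST (simultaneously triangularizable). (ii) For every integer $n\geq 3$ there exist complex $n\times n$ matrices $A,B$ such that, with $C=AB-BA$, one has $CA=AC$ and both of the following hold: - the pair $(A,B)$ does not have property L; - $B$ and $C$ are not ST.
   Context: Two complex $n\times n$ matrices $X,Y$ are said to be ST (simultaneously triangularizable) if there exists an invertible complex $n\times n$ matrix $P$ such that $P^{-1}XP$ and $P^{-1}YP$ are both upper triangular. A pair $(X,Y)$ of complex $n\times n$ matrices is said to have property L (of Motzkin-Taussky) if there are orderings $(\lambda_i)_{i\leq n}$ and $(\mu_i)_{i\leq n}$ of the eigenvalues of $X$ and $Y$ respectively (counted with algebraic multiplicity) such that, for all complex numbers $x,y$, the eigenvalues of $xX+yY$ (counted with algebraic multiplicity) are $(x\lambda_i+y\mu_i)_{i\leq n}$. *)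

theory Defs
  imports "Jordan_Normal_Form.Char_Poly"
begin

definition simult_triangularizable :: "nat \<Rightarrow> complex mat \<Rightarrow> complex mat \<Rightarrow> bool" where
  "simult_triangularizable n X Y \<longleftrightarrow>
     (\<exists>P \<in> carrier_mat n n. \<exists>Q \<in> carrier_mat n n.
        P * Q = 1\<^sub>m n \<and> Q * P = 1\<^sub>m n \<and>
        upper_triangular (Q * X * P) \<and> upper_triangular (Q * Y * P))"

text \<open>Algebraic multiplicity is the multiplicity as a root of the characteristic polynomial.\<close>

definition eigenvalues_mset :: "complex mat \<Rightarrow> complex multiset" where
  "eigenvalues_mset X = proots (char_poly X)"

definition property_L :: "nat \<Rightarrow> complex mat \<Rightarrow> complex mat \<Rightarrow> bool" where
  "property_L n X Y \<longleftrightarrow>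
     (\<exists>l m :: nat \<Rightarrow> complex.
        eigenvalues_mset X = image_mset l (mset_set {..<n}) \<and>
        eigenvalues_mset Y = image_mset m (mset_set {..<n}) \<and>
        (\<forall>x y :: complex. eigenvalues_mset (x \<cdot>\<^sub>m X + y \<cdot>\<^sub>m Y) =
           image_mset (\<lambda>i. x * l i + y * m i) (mset_set {..<n})))"

definition mat_commutator :: "complex mat \<Rightarrow> complex mat \<Rightarrow> complex mat" where
  "mat_commutator A B = A * B - B * A"

end

theory Submission
  imports Defs "Jordan_Normal_Form.Schur_Decomposition"
begin

text \<open>
  For \<open>2 \<times> 2\<close> matrices, triangularize \<open>A\<close>. If \<open>A\<close> is upper triangular and \<open>B\<close> has lower left
  entry \<open>r \<noteq> 0\<close>, the off-diagonal entries of \<open>CA = AC\<close> force first the diagonal entries of \<open>A\<close> to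
  coincide and then its upper right entry to vanish. So \<open>A\<close> is scalar, and any triangularization
  of \<open>B\<close> works.

  For \<open>n \<ge> 3\<close>, number the basis from 0 and take \<open>A = E\<^sub>2\<^sub>0\<close>, \<open>B = E\<^sub>0\<^sub>1 + E\<^sub>1\<^sub>2\<close>,
  so that \<open>C = E\<^sub>2\<^sub>1 - E\<^sub>1\<^sub>0\<close>. Both \<open>A\<close> and \<open>B\<close> are nilpotent, but \<open>A + B\<close> permutes three basis
  vectors cyclically and has eigenvalue 1, contradicting property L. If \<open>B\<close> and \<open>C\<close> were
  simultaneously triangularizable, \<open>BC\<close> would be nilpotent together with \<open>B\<close>; but
  \<open>BC = E\<^sub>1\<^sub>1 - E\<^sub>0\<^sub>0\<close>.
\<close>

section \<open>Conjugation and complex triangularization\<close>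

lemma conjugate_mult_mat:
  fixes P Q X Y :: "'a :: semiring_1 mat"
  assumes "P \<in> carrier_mat n n" "Q \<in> carrier_mat n n" "X \<in> carrier_mat n n" "Y \<in> carrier_mat n n"
    and PQ: "P * Q = 1\<^sub>m n"
  shows "(Q * X * P) * (Q * Y * P) = Q * (X * Y) * P"
proof -
  have "(Q * X * P) * (Q * Y * P) = Q * X * (P * Q) * Y * P"
    using assms(1-4) by (simp add: assoc_mult_mat[of _ n n _ n _ n])
  also have "\<dots> = Q * (X * Y) * P"
    using assms by (simp add: assoc_mult_mat[of _ n n _ n _ n])
  finally show ?thesis .
qed

lemma conjugate_minus_mat:
  fixes P Q X Y :: "'a :: ring_1 mat"
  assumes "P \<in> carrier_mat n n" "Q \<in> carrier_mat n n" "X \<in> carrier_mat n n" "Y \<in> carrier_mat n n"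
  shows "Q * (X - Y) * P = Q * X * P - Q * Y * P"
  using assms
  by (simp add: mult_minus_distrib_mat[of _ n n _ n] minus_mult_distrib_mat[of _ n n _ _ n])

text \<open>Conjugation is additive and, since \<open>P * Q\<close> is the identity, multiplicative.
  This carries the hypothesis on \<open>C\<close> to a basis in which \<open>A\<close> is
  triangular.\<close>

lemma conjugate_commutator:
  assumes "P \<in> carrier_mat n n" "Q \<in> carrier_mat n n" "X \<in> carrier_mat n n" "Y \<in> carrier_mat n n"
    and "P * Q = 1\<^sub>m n"
  shows "mat_commutator (Q * X * P) (Q * Y * P) = Q * mat_commutator X Y * P"
  unfolding mat_commutator_def conjugate_mult_mat[OF assms]
    conjugate_mult_mat[OF assms(1,2,4,3,5)]
  using assms by (intro conjugate_minus_mat[symmetric, of P n Q]) auto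

text \<open>Over the complex numbers the characteristic polynomial splits into linear factors, which
  is what the Schur decomposition requires.\<close>

lemma complex_triangularizable:
  fixes A :: "complex mat"
  assumes A: "A \<in> carrier_mat n n"
  obtains P Q where "P \<in> carrier_mat n n" "Q \<in> carrier_mat n n" "P * Q = 1\<^sub>m n" "Q * P = 1\<^sub>m n"
    "upper_triangular (Q * A * P)"
proof -
  obtain as where "char_poly A = (\<Prod>a\<leftarrow>as. [:- a, 1:])"
    using char_poly_factorized[OF A] by blast
  from schur_decomposition_exists[OF A this] obtain B P Q
    where up: "upper_triangular B" and wit: "similar_mat_wit A B P Q"
    unfolding similar_mat_def by blast
  note w = similar_mat_witD2[OF A wit]
  \<comment> \<open>The witness reads \<open>A = P * B * Q\<close>; its symmetric form solves for
    \<open>B\<close>.\<close>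
  have "B = Q * A * P"
    using similar_mat_witD2(3)[OF w(5) similar_mat_wit_sym[OF wit]] .
  with up have "upper_triangular (Q * A * P)" by simp
  with w(6,7,1,2) show ?thesis by (rule that)
qed

section \<open>The 2 by 2 case\<close>

lemma two_by_two_mult_index:
  fixes X Y :: "'a :: semiring_1 mat"
  assumes "X \<in> carrier_mat 2 2" "Y \<in> carrier_mat 2 2" "i < 2" "j < 2"
  shows "(X * Y) $$ (i, j) = X $$ (i, 0) * Y $$ (0, j) + X $$ (i, 1) * Y $$ (1, j)"
  using assms by (simp add: scalar_prod_def numeral_2_eq_2)

lemma two_by_two_upper_case:
  fixes A B :: "complex mat"
  assumes A: "A \<in> carrier_mat 2 2" and B: "B \<in> carrier_mat 2 2"
    and up: "upper_triangular A"
    and comm: "mat_commutator A B * A = A * mat_commutator A B"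
  shows "upper_triangular B \<or> A = A $$ (0, 0) \<cdot>\<^sub>m 1\<^sub>m 2"
proof (cases "B $$ (1, 0) = 0")
  case True
  then show ?thesis using B by (auto simp: upper_triangular_def less_2_cases_iff)
next
  case False
  define C where "C = mat_commutator A B"
  have C: "C \<in> carrier_mat 2 2" using A B by (simp add: C_def mat_commutator_def minus_carrier_mat)
  have a: "A $$ (1, 0) = 0" using up A by (auto simp: upper_triangular_def)
  have Cij: "C $$ (i, j) = (A * B) $$ (i, j) - (B * A) $$ (i, j)" if "i < 2" "j < 2" for i j
    using that A B by (simp add: C_def mat_commutator_def)
  have ij: "(C * A) $$ (i, j) = (A * C) $$ (i, j)" for i j
    using comm by (simp add: C_def)
  note prods = two_by_two_mult_index[OF C A] two_by_two_mult_index[OF A C]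
    two_by_two_mult_index[OF A B] two_by_two_mult_index[OF B A]
  \<comment> \<open>The lower left entry of \<open>C\<close> is \<open>B $$ (1, 0)\<close> times the
    difference of the diagonal entries of \<open>A\<close>; commuting with \<open>A\<close> brings
    in that difference once more.\<close>
  have "(A $$ (0, 0) - A $$ (1, 1))\<^sup>2 * B $$ (1, 0) = 0"
    using ij[of 1 0] a by (simp add: prods Cij power2_eq_square algebra_simps)
  then have d: "A $$ (1, 1) = A $$ (0, 0)" using False by simp
  \<comment> \<open>Now \<open>C\<close> is upper triangular with opposite diagonal entries,
    \<open>A $$ (0, 1) * B $$ (1, 0)\<close> and its negative; their difference gives the factor
    2.\<close>
  have "2 * (A $$ (0, 1))\<^sup>2 * B $$ (1, 0) = 0"
    using ij[of 0 1] a d by (simp add: prods Cij power2_eq_square algebra_simps)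
  then have "A $$ (0, 1) = 0" using False by simp
  then have "A = A $$ (0, 0) \<cdot>\<^sub>m 1\<^sub>m 2"
    using A a d by (intro eq_matI) (auto simp: less_2_cases_iff)
  then show ?thesis ..
qed

lemma simult_triangularizable_two_by_two:
  assumes A: "A \<in> carrier_mat 2 2" and B: "B \<in> carrier_mat 2 2"
    and comm: "mat_commutator A B * A = A * mat_commutator A B"
  shows "simult_triangularizable 2 A B"
proof -
  obtain P Q where P: "P \<in> carrier_mat 2 2" and Q: "Q \<in> carrier_mat 2 2"
    and PQ: "P * Q = 1\<^sub>m 2" and QP: "Q * P = 1\<^sub>m 2" and up: "upper_triangular (Q * A * P)"
    using complex_triangularizable[OF A] .
  let ?A = "Q * A * P" and ?B = "Q * B * P"
  have C: "mat_commutator A B \<in> carrier_mat 2 2" using A B by (simp add: mat_commutator_def minus_carrier_mat)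
  have "mat_commutator ?A ?B * ?A = ?A * mat_commutator ?A ?B"
    unfolding conjugate_commutator[OF P Q A B PQ] conjugate_mult_mat[OF P Q A C PQ]
      conjugate_mult_mat[OF P Q C A PQ] comm ..
  from two_by_two_upper_case[OF _ _ up this]
  consider "upper_triangular ?B" | "?A = ?A $$ (0, 0) \<cdot>\<^sub>m 1\<^sub>m 2"
    using A B P Q by fastforce
  then show ?thesis
  proof cases
    case 1
    then show ?thesis using P Q PQ QP up unfolding simult_triangularizable_def by blast
  next
    case 2
    define c where "c = ?A $$ (0, 0)"
    have c: "?A = c \<cdot>\<^sub>m 1\<^sub>m 2" unfolding c_def by (fact 2)
    \<comment> \<open>A scalar matrix is the same in every basis, so conjugating back shows that
      \<open>A\<close> itself is scalar.\<close>
    have "A = P * ?A * Q"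
    proof -
      have "P * ?A * Q = (P * Q) * A * (P * Q)"
        using A P Q by (simp add: assoc_mult_mat[of _ 2 2 _ 2 _ 2])
      then show ?thesis using A PQ by simp
    qed
    also have "\<dots> = c \<cdot>\<^sub>m 1\<^sub>m 2"
      unfolding c using P Q PQ by (simp add: mult_smult_distrib[of _ 2 2 _ 2] mult_smult_assoc_mat[of _ 2 2 _ 2])
    finally have A': "A = c \<cdot>\<^sub>m 1\<^sub>m 2" .
    obtain R S where R: "R \<in> carrier_mat 2 2" and S: "S \<in> carrier_mat 2 2"
      and RS: "R * S = 1\<^sub>m 2" and SR: "S * R = 1\<^sub>m 2" and upB: "upper_triangular (S * B * R)"
      using complex_triangularizable[OF B] .
    have "S * A * R = c \<cdot>\<^sub>m 1\<^sub>m 2"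
      unfolding A' using R S SR by (simp add: mult_smult_distrib[of _ 2 2 _ 2] mult_smult_assoc_mat[of _ 2 2 _ 2])
    then have "upper_triangular (S * A * R)" by (auto simp: upper_triangular_def)
    then show ?thesis using R S RS SR upB unfolding simult_triangularizable_def by blast
  qed
qed

section \<open>Eigenvalue obstructions to simultaneous triangularization and to property L\<close>

lemma eigenvalue_upper_triangular_iff:
  fixes A :: "'a :: field mat"
  assumes A: "A \<in> carrier_mat n n" and up: "upper_triangular A"
  shows "eigenvalue A k \<longleftrightarrow> (\<exists>i<n. k = A $$ (i, i))"
proof -
  have roots: "poly (\<Prod>a\<leftarrow>as. [:- a, 1:]) k = 0 \<longleftrightarrow> k \<in> set as" for as :: "'a list"
    by (induction as) auto
  have "eigenvalue A k \<longleftrightarrow> k \<in> set (diag_mat A)"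
    unfolding eigenvalue_root_char_poly[OF A] char_poly_upper_triangular[OF A up] roots ..
  also have "set (diag_mat A) = (\<lambda>i. A $$ (i, i)) ` {0..<n}"
    using carrier_matD(1)[OF A] by (simp add: diag_mat_def)
  also have "k \<in> \<dots> \<longleftrightarrow> (\<exists>i<n. k = A $$ (i, i))"
    by (simp add: image_iff Bex_def)
  finally show ?thesis .
qed

text \<open>A nonzero term \<open>A $$ (i, k) * B $$ (k, j)\<close> needs \<open>i \<le> k\<close>
  and \<open>k \<le> j\<close>, so \<open>j \<le> i\<close> leaves only \<open>k = i = j\<close>.
  This yields both triangularity and the diagonal of the product.\<close>

lemma upper_triangular_mult_index:
  fixes A B :: "'a :: semiring_1 mat"
  assumes A: "A \<in> carrier_mat n n" and B: "B \<in> carrier_mat n n"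
    and upA: "upper_triangular A" and upB: "upper_triangular B"
    and ij: "j \<le> i" "i < n"
  shows "(A * B) $$ (i, j) = (if i = j then A $$ (i, i) * B $$ (i, i) else 0)"
proof -
  have "(A * B) $$ (i, j) = (\<Sum>k\<in>{0..<n}. A $$ (i, k) * B $$ (k, j))"
    using A B ij by (simp add: scalar_prod_def)
  also have "\<dots> = (\<Sum>k\<in>{0..<n}. if k = i \<and> i = j then A $$ (i, i) * B $$ (i, i) else 0)"
  proof (rule sum.cong)
    fix k assume k: "k \<in> {0..<n}"
    consider "k < i" | "k = i" | "k > i" by linarith
    then show "A $$ (i, k) * B $$ (k, j) = (if k = i \<and> i = j then A $$ (i, i) * B $$ (i, i) else 0)"
      using k ij A B upA upB by cases (auto simp: upper_triangular_def)
  qed simp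
  also have "\<dots> = (if i = j then A $$ (i, i) * B $$ (i, i) else 0)"
    using ij by auto
  finally show ?thesis .
qed

text \<open>In a common triangular basis the diagonal of \<open>X * Y\<close> is the entrywise
  product of the two diagonals, and that of \<open>X\<close> is zero. Nilpotency is expressed
  through eigenvalues.\<close>

lemma simult_triangularizable_nilpotent_mult:
  assumes X: "X \<in> carrier_mat n n" and Y: "Y \<in> carrier_mat n n"
    and ST: "simult_triangularizable n X Y"
    and nil: "\<And>k. eigenvalue X k \<Longrightarrow> k = 0"
    and ev: "eigenvalue (X * Y) k"
  shows "k = 0"
proof -
  obtain P Q where P: "P \<in> carrier_mat n n" and Q: "Q \<in> carrier_mat n n"
    and PQ: "P * Q = 1\<^sub>m n" and QP: "Q * P = 1\<^sub>m n"
    and up: "upper_triangular (Q * X * P)" "upper_triangular (Q * Y * P)"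
    using ST unfolding simult_triangularizable_def by blast
  have QZP: "Q * Z * P \<in> carrier_mat n n" if "Z \<in> carrier_mat n n" for Z
    using that P Q by simp
  have eig: "eigenvalue (Q * Z * P) c \<longleftrightarrow> eigenvalue Z c" if Z: "Z \<in> carrier_mat n n" for Z c
  proof -
    have "similar_mat (Q * Z * P) Z"
      by (rule similar_matI[of _ _ Q P n]) (use P Q PQ QP Z in auto)
    from char_poly_similar[OF this] show ?thesis
      by (simp add: eigenvalue_root_char_poly[OF Z] eigenvalue_root_char_poly[OF QZP[OF Z]])
  qed
  let ?XY = "Q * X * P * (Q * Y * P)"
  have diag: "(Q * X * P) $$ (i, i) = 0" if "i < n" for i
    using nil eig[OF X] eigenvalue_upper_triangular_iff[OF QZP[OF X] up(1)] that by blast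
  note idx = upper_triangular_mult_index[OF QZP[OF X] QZP[OF Y] up]
  have up': "upper_triangular ?XY"
    using idx P Q X Y by (auto simp: upper_triangular_def simp del: index_mult_mat(1))
  have "eigenvalue ?XY k"
    using ev eig[of "X * Y"] X Y unfolding conjugate_mult_mat[OF P Q X Y PQ] by simp
  then obtain i where "i < n" "k = ?XY $$ (i, i)"
    using eigenvalue_upper_triangular_iff[OF mult_carrier_mat[OF QZP[OF X] QZP[OF Y]] up'] by blast
  then show ?thesis using idx[of i i] diag by simp
qed

lemma set_eigenvalues_mset:
  assumes X: "X \<in> carrier_mat n n"
  shows "set_mset (eigenvalues_mset X) = {k. eigenvalue X k}"
proof -
  \<comment> \<open>\<open>proots\<close> collects exactly the roots only for a nonzero polynomial;
    being monic ensures this.\<close>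
  have "char_poly X \<noteq> 0" using degree_monic_char_poly[OF X] by auto
  then show ?thesis
    by (simp add: eigenvalues_mset_def eigenvalue_root_char_poly[OF X])
qed

text \<open>Take \<open>x = y = 1\<close> in property L: each eigenvalue of \<open>X + Y\<close> is
  a sum of an eigenvalue of \<open>X\<close> and one of \<open>Y\<close>, both zero.\<close>

lemma property_L_nilpotent_add:
  assumes X: "X \<in> carrier_mat n n" and Y: "Y \<in> carrier_mat n n"
    and L: "property_L n X Y"
    and nil: "\<And>k. eigenvalue X k \<Longrightarrow> k = 0" "\<And>k. eigenvalue Y k \<Longrightarrow> k = 0"
    and ev: "eigenvalue (X + Y) k"
  shows "k = 0"
proof -
  obtain l m where l: "eigenvalues_mset X = image_mset l (mset_set {..<n})"
    and m: "eigenvalues_mset Y = image_mset m (mset_set {..<n})"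
    and lm: "\<And>x y. eigenvalues_mset (x \<cdot>\<^sub>m X + y \<cdot>\<^sub>m Y) =
           image_mset (\<lambda>i. x * l i + y * m i) (mset_set {..<n})"
    using L unfolding property_L_def by blast
  have one: "1 \<cdot>\<^sub>m Z = Z" for Z :: "complex mat" by (intro eq_matI) auto
  have "k \<in> set_mset (eigenvalues_mset (X + Y))"
    using ev set_eigenvalues_mset[of "X + Y" n] X Y by simp
  then obtain i where i: "i < n" "k = l i + m i"
    using lm[of 1 1] by (auto simp: one)
  have "l i = 0" "m i = 0"
    using nil set_eigenvalues_mset[OF X] set_eigenvalues_mset[OF Y] l m i(1) by force+
  then show ?thesis using i by simp
qed

section \<open>Matrix units and the counterexample\<close>

definition mat_unit :: "nat \<Rightarrow> nat \<Rightarrow> nat \<Rightarrow> 'a :: semiring_1 mat" where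
  "mat_unit n i j = mat n n (\<lambda>(k, l). if k = i \<and> l = j then 1 else 0)"

lemma mat_unit_carrier [simp]: "mat_unit n i j \<in> carrier_mat n n"
  by (simp add: mat_unit_def)

lemma mat_unit_dim [simp]: "dim_row (mat_unit n i j) = n" "dim_col (mat_unit n i j) = n"
  by (simp_all add: mat_unit_def)

lemma mat_unit_index [simp]:
  "k < n \<Longrightarrow> l < n \<Longrightarrow> mat_unit n i j $$ (k, l) = (if k = i \<and> l = j then 1 else 0)"
  by (simp add: mat_unit_def)

text \<open>The range bounds matter when \<open>j = k\<close>: an inner index outside the matrix
  would make the product zero, while \<open>mat_unit n i l\<close> may be nonzero.\<close>

lemma mat_unit_mult:
  assumes "j < n" "k < n"
  shows "(mat_unit n i j :: 'a :: semiring_1 mat) * mat_unit n k l = (if j = k then mat_unit n i l else 0\<^sub>m n n)"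
proof (intro eq_matI)
  fix p q assume "p < dim_row (if j = k then mat_unit n i l else 0\<^sub>m n n)"
    and "q < dim_col (if j = k then mat_unit n i l else 0\<^sub>m n n)"
  then have pq: "p < n" "q < n" by (auto split: if_splits)
  have "((mat_unit n i j :: 'a mat) * mat_unit n k l) $$ (p, q) =
      (\<Sum>s\<in>{0..<n}. mat_unit n i j $$ (p, s) * mat_unit n k l $$ (s, q))"
    using pq by (simp add: scalar_prod_def)
  also have "\<dots> = (\<Sum>s\<in>{0..<n}. if s = j then if p = i \<and> j = k \<and> q = l then 1 else 0 else 0)"
    using pq by (intro sum.cong) auto
  also have "\<dots> = (if p = i \<and> j = k \<and> q = l then 1 else 0)" using assms by simp
  finally show "((mat_unit n i j :: 'a mat) * mat_unit n k l) $$ (p, q) =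
      (if j = k then mat_unit n i l else 0\<^sub>m n n) $$ (p, q)"
    using pq by auto
qed auto

lemma mat_unit_mult_vec:
  assumes "j < n" "v \<in> carrier_vec n"
  shows "mat_unit n i j *\<^sub>v v = vec n (\<lambda>k. if k = i then v $ j else 0)"
proof (intro eq_vecI)
  fix p assume "p < dim_vec (vec n (\<lambda>k. if k = i then v $ j else 0))"
  then have p: "p < n" by simp
  have "(mat_unit n i j *\<^sub>v v) $ p = (\<Sum>s\<in>{0..<n}. mat_unit n i j $$ (p, s) * v $ s)"
    using p assms by (simp add: scalar_prod_def)
  also have "\<dots> = (\<Sum>s\<in>{0..<n}. if s = j then if p = i then v $ j else 0 else 0)"
    using p by (intro sum.cong) auto
  also have "\<dots> = (if p = i then v $ j else 0)" using assms by simp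
  finally show "(mat_unit n i j *\<^sub>v v) $ p = vec n (\<lambda>k. if k = i then v $ j else 0) $ p"
    using p by simp
qed simp

lemma commutator_counterexample:
  assumes n: "n \<ge> 3"
  shows "\<exists>A \<in> carrier_mat n n. \<exists>B \<in> carrier_mat n n.
            mat_commutator A B * A = A * mat_commutator A B \<and>
            \<not> property_L n A B \<and>
            \<not> simult_triangularizable n B (mat_commutator A B)"
proof -
  let ?E = "mat_unit n :: nat \<Rightarrow> nat \<Rightarrow> complex mat"
  define A where "A = ?E 2 0"
  define B where "B = ?E 0 1 + ?E 1 2"
  have A: "A \<in> carrier_mat n n" and B: "B \<in> carrier_mat n n" by (simp_all add: A_def B_def)
  note distribs = add_mult_distrib_mat[of _ n n _ _ n] mult_add_distrib_mat[of _ n n _ n]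
    minus_mult_distrib_mat[of _ n n _ _ n] mult_minus_distrib_mat[of _ n n _ n]
  have C: "mat_commutator A B = ?E 2 1 - ?E 1 0"
    using n by (simp add: mat_commutator_def A_def B_def distribs mat_unit_mult)
  \<comment> \<open>Both products vanish, since no inner indices of the matrix units match.\<close>
  have comm: "mat_commutator A B * A = A * mat_commutator A B"
    using n unfolding C by (simp add: A_def distribs mat_unit_mult)
  have BC: "B * mat_commutator A B = ?E 1 1 - ?E 0 0"
    using n unfolding C
    by (simp add: B_def distribs mat_unit_mult)
  have nilA: "k = 0" if "eigenvalue A k" for k
  proof -
    \<comment> \<open>\<open>A\<close> is strictly lower triangular; transposing keeps the
      characteristic polynomial and makes the diagonal criterion applicable.\<close>
    have T: "transpose_mat A \<in> carrier_mat n n" using A by simp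
    have up: "upper_triangular (transpose_mat A)"
      using n by (auto simp: A_def upper_triangular_def)
    have "eigenvalue (transpose_mat A) k"
      using that A by (simp add: eigenvalue_root_char_poly[OF A] eigenvalue_root_char_poly[OF T])
    then show ?thesis
      using n unfolding eigenvalue_upper_triangular_iff[OF T up] by (auto simp: A_def)
  qed
  have nilB: "k = 0" if "eigenvalue B k" for k
  proof -
    have up: "upper_triangular B" using n by (auto simp: B_def upper_triangular_def)
    show ?thesis
      using that n unfolding eigenvalue_upper_triangular_iff[OF B up] by (auto simp: B_def)
  qed
  have evBC: "eigenvalue (B * mat_commutator A B) 1"
  proof -
    have M: "?E 1 1 - ?E 0 0 \<in> carrier_mat n n" by (simp add: minus_carrier_mat)
    have up: "upper_triangular (?E 1 1 - ?E 0 0)" by (auto simp: upper_triangular_def)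
    show ?thesis
      unfolding BC eigenvalue_upper_triangular_iff[OF M up] using n by (intro exI[of _ 1]) auto
  qed
  have evAB: "eigenvalue (A + B) 1"
  proof -
    \<comment> \<open>The sum of the three cyclically permuted basis vectors is fixed by
      \<open>A + B\<close>; the remaining coordinates are 0 because \<open>A + B\<close> kills the
      other basis vectors.\<close>
    define v :: "complex vec" where "v = vec n (\<lambda>i. if i < 3 then 1 else 0)"
    have v: "v \<in> carrier_vec n" by (simp add: v_def)
    have "v $ 0 \<noteq> 0" using n by (simp add: v_def)
    then have "v \<noteq> 0\<^sub>v n" using n by auto
    moreover have "(A + B) *\<^sub>v v = 1 \<cdot>\<^sub>v v"
      using n v unfolding A_def B_def
      by (simp add: add_mult_distrib_mat_vec[of _ n n] mat_unit_mult_vec)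
        (intro eq_vecI; auto simp: v_def)
    ultimately show ?thesis using v B unfolding eigenvalue_def eigenvector_def by auto
  qed
  have Cc: "mat_commutator A B \<in> carrier_mat n n" unfolding C by (simp add: minus_carrier_mat)
  have "\<not> property_L n A B"
    using property_L_nilpotent_add[OF A B _ nilA nilB evAB] by auto
  moreover have "\<not> simult_triangularizable n B (mat_commutator A B)"
    using simult_triangularizable_nilpotent_mult[OF B Cc _ nilB evBC] by auto
  ultimately show ?thesis using A B comm by blast
qed

theorem proposition3:
  shows "(\<forall>A \<in> carrier_mat 2 2. \<forall>B \<in> carrier_mat 2 2.
            mat_commutator A B * A = A * mat_commutator A B \<longrightarrow>
            simult_triangularizable 2 A B) \<and>
         (\<forall>n \<ge> 3. \<exists>A \<in> carrier_mat n n. \<exists>B \<in> carrier_mat n n.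
            mat_commutator A B * A = A * mat_commutator A B \<and>
            \<not> property_L n A B \<and>
            \<not> simult_triangularizable n B (mat_commutator A B))"
  using simult_triangularizable_two_by_two commutator_counterexample by blast

end
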